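(* For every integer $r\ge1$: (a) $N_{2r}(1)=3^r$ and $N_{2r+1}(1)=8\cdot3^{r-1}$. (b) $(2r)!\,\mathrm{vol}(\mathcal P_{2r}^{(1)})=\dfrac{(2r)!}{2^r}$ and $(2r+1)!\,\mathrm{vol}(\mathcal P_{2r+1}^{(1)})=\dfrac{5\,(2r+1)!}{6\cdot2^{r-1}}$.
   Context: For integers $d\ge2$ and $s\ge1$ let $$\mathcal P_d^{(s)}=\{x=(x_1,\dots,x_d)\in\mathbb R_{\ge0}^d:\ x_i+x_{i+1}\le s+\delta_i,\ 1\le i\le d-1\},$$ where $\delta_i=0$ for $i$ odd and $\delta_i=1$ for $i$ even. $N_d(s):=\#(\mathcal P_d^{(s)}\cap\mathbb Z^d)$, and $\mathrm{vol}$ is Euclidean $d$-dimensional volume. *)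

theory Defs
  imports "HOL-Analysis.Analysis"
begin

text \<open>
  Since the dimension d varies, points of d-dimensional real space are functions on the index
  set \<open>{1..d}\<close>, extended by \<^term>\<open>undefined\<close> elsewhere so that each point has exactly one
  representative. This is the underlying space of the product measure \<^const>\<open>PiM\<close>.
\<close>

definition delta :: "nat \<Rightarrow> nat" where
  "delta i = (if odd i then 0 else 1)"

definition polytope_P :: "nat \<Rightarrow> nat \<Rightarrow> (nat \<Rightarrow> real) set" where
  "polytope_P d s =
     {x \<in> {1..d} \<rightarrow>\<^sub>E {0..}. \<forall>i\<in>{1..d-1}. x i + x (i + 1) \<le> real (s + delta i)}"

definition lattice_points :: "nat \<Rightarrow> (nat \<Rightarrow> real) set" where
  "lattice_points d = {1..d} \<rightarrow>\<^sub>E \<int>"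

definition num_lattice :: "nat \<Rightarrow> nat \<Rightarrow> nat" where
  "num_lattice d s = card (polytope_P d s \<inter> lattice_points d)"

definition euclidean_vol :: "nat \<Rightarrow> (nat \<Rightarrow> real) set \<Rightarrow> real" where
  "euclidean_vol d A = measure (PiM {1..d} (\<lambda>_. lborel)) A"

end

theory Submission
  imports Defs
begin

text \<open>
  At \<open>s = 1\<close> most even-numbered constraints are redundant. Since the coordinates are
  nonnegative, the odd-numbered constraint \<open>x\<^bsub>2k-1\<^esub> + x\<^bsub>2k\<^esub> \<le> 1\<close> forces \<open>x\<^bsub>2k\<^esub> \<le> 1\<close>, and the
  next one, \<open>x\<^bsub>2k+1\<^esub> + x\<^bsub>2k+2\<^esub> \<le> 1\<close>, forces \<open>x\<^bsub>2k+1\<^esub> \<le> 1\<close>. Together they imply the constraint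
  \<open>x\<^bsub>2k\<^esub> + x\<^bsub>2k+1\<^esub> \<le> 2\<close> between them, which therefore matters only if \<open>2k + 1\<close> is the last
  index. Hence the polytope in dimension \<open>2r\<close> is a product of \<open>r\<close> triangles \<open>{x + y \<le> 1}\<close>, and
  the one in dimension \<open>2r + 1\<close> is a product of \<open>r - 1\<close> triangles and one three-dimensional block
  \<open>{x + y \<le> 1, y + z \<le> 2}\<close> (\<open>polytope_P_split\<close>). Volume and number of lattice points are
  multiplicative under such products (\<open>measure_glue\<close>, \<open>card_glue\<close>).

  Both blocks have one central coordinate \<open>y\<close> that occurs in every constraint. For fixed \<open>y\<close>
  the remaining coordinates range over a box. The volume is therefore the integral over \<open>y\<close> of
  the volume of that box, and the number of lattice points is the sum of the numbers of lattice
  points in the boxes over integral \<open>y\<close> (\<open>emeasure_star\<close>, \<open>card_star_Ints\<close>). The triangle has volume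
  \<open>\<integral>\<^sub>0\<^sup>1 (1 - y) dy = 1/2\<close> and \<open>2 + 1 = 3\<close> lattice points. The other block has
  volume \<open>\<integral>\<^sub>0\<^sup>1 (1 - y)(2 - y) dy = 5/6\<close> and \<open>2 \<sqdot> 3 + 1 \<sqdot> 2 = 8\<close> lattice points.
\<close>

section \<open>Products of sets of points over disjoint index sets\<close>

text \<open>
  The product \<open>A \<times> B\<close>, with a pair of points on \<open>I\<close> and \<open>J\<close> read as one point on \<open>I \<union> J\<close>. In this
  form the blocks of the polytope keep their own indices and no coordinate has to be renumbered.
\<close>

definition glue :: "'i set \<Rightarrow> ('i \<Rightarrow> 'a) set \<Rightarrow> 'i set \<Rightarrow> ('i \<Rightarrow> 'a) set \<Rightarrow> ('i \<Rightarrow> 'a) set" where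
  "glue I A J B = {x \<in> extensional (I \<union> J). restrict x I \<in> A \<and> restrict x J \<in> B}"

lemma glue_Int_PiE:
  "glue I A J B \<inter> (I \<union> J \<rightarrow>\<^sub>E Z) = glue I (A \<inter> (I \<rightarrow>\<^sub>E Z)) J (B \<inter> (J \<rightarrow>\<^sub>E Z))"
  unfolding glue_def by (auto simp: PiE_iff extensional_def)

lemma card_glue:
  assumes "I \<inter> J = {}" "A \<subseteq> extensional I" "B \<subseteq> extensional J"
  shows "card (glue I A J B) = card A * card B"
proof -
  have "bij_betw (\<lambda>x. (restrict x I, restrict x J)) (glue I A J B) (A \<times> B)"
  proof (rule bij_betw_byWitness[where f' = "merge I J"])
    show "\<forall>x\<in>glue I A J B. merge I J (restrict x I, restrict x J) = x"
      by (auto simp: glue_def merge_def extensional_def fun_eq_iff)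
    show "\<forall>p\<in>A \<times> B. (restrict (merge I J p) I, restrict (merge I J p) J) = p"
      using assms by (auto simp: subset_iff extensional_restrict)
    show "(\<lambda>x. (restrict x I, restrict x J)) ` glue I A J B \<subseteq> A \<times> B"
      by (auto simp: glue_def)
    show "merge I J ` (A \<times> B) \<subseteq> glue I A J B"
      using assms by (auto simp: glue_def subset_iff extensional_restrict)
  qed
  then show ?thesis
    by (simp add: bij_betw_same_card card_cartesian_product)
qed

lemma measure_glue:
  fixes A B :: "('i \<Rightarrow> real) set"
  assumes "finite I" "finite J" "I \<inter> J = {}"
    and A: "A \<in> sets (PiM I (\<lambda>_. lborel))" and B: "B \<in> sets (PiM J (\<lambda>_. lborel))"
  shows "measure (PiM (I \<union> J) (\<lambda>_. lborel)) (glue I A J B)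
       = measure (PiM I (\<lambda>_. lborel)) A * measure (PiM J (\<lambda>_. lborel)) B"
proof -
  interpret product_sigma_finite "\<lambda>_::'i. lborel :: real measure"
    by unfold_locales
  interpret J: sigma_finite_measure "PiM J (\<lambda>_. lborel :: real measure)"
    using \<open>finite J\<close> by (rule sigma_finite)
  let ?MI = "PiM I (\<lambda>_. lborel :: real measure)"
  let ?MJ = "PiM J (\<lambda>_. lborel :: real measure)"
  let ?M = "PiM (I \<union> J) (\<lambda>_. lborel :: real measure)"
  have "glue I A J B
      = (\<lambda>x. restrict x I) -` A \<inter> ((\<lambda>x. restrict x J) -` B \<inter> space ?M) \<inter> space ?M"
    by (auto simp: glue_def space_PiM PiE_UNIV_domain PiE_def)
  also have "\<dots> = ((\<lambda>x. restrict x I) -` A \<inter> space ?M) \<inter> ((\<lambda>x. restrict x J) -` B \<inter> space ?M)"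
    by auto
  also have "\<dots> \<in> sets ?M"
    using measurable_sets[OF measurable_restrict_subset[OF Un_upper1] A]
      measurable_sets[OF measurable_restrict_subset[OF Un_upper2] B] by (rule sets.Int)
  finally have C: "glue I A J B \<in> sets ?M" .
  have ext: "A \<subseteq> extensional I" "B \<subseteq> extensional J"
    using sets.sets_into_space[OF A] sets.sets_into_space[OF B]
    by (auto simp: space_PiM PiE_def)
  have pre: "merge I J -` glue I A J B \<inter> space (?MI \<Otimes>\<^sub>M ?MJ) = A \<times> B"
    using assms(3) ext
    by (auto simp: glue_def space_pair_measure space_PiM PiE_def subset_iff extensional_restrict)
  have "emeasure ?M (glue I A J B)
      = emeasure (distr (?MI \<Otimes>\<^sub>M ?MJ) ?M (merge I J)) (glue I A J B)"
    using assms by (simp add: distr_merge)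
  also have "\<dots> = emeasure ?MI A * emeasure ?MJ B"
    using C A B by (simp add: emeasure_distr pre J.emeasure_pair_measure_Times)
  finally show ?thesis
    by (simp add: measure_def enn2real_mult)
qed

text \<open>
  Measurability of the polytope and of the blocks: both have constraints that bound sums of two
  coordinates.
\<close>

lemma sets_pairwise_bounded:
  fixes b :: "'j \<Rightarrow> real"
  assumes "finite K" "finite C" "\<And>i. i \<in> C \<Longrightarrow> f i \<in> K" "\<And>i. i \<in> C \<Longrightarrow> g i \<in> K"
  shows "{x \<in> K \<rightarrow>\<^sub>E {0..}. \<forall>i\<in>C. x (f i) + x (g i) \<le> b i} \<in> sets (PiM K (\<lambda>_. lborel))"
proof -
  let ?M = "PiM K (\<lambda>_. lborel :: real measure)"
  have coord: "(\<lambda>x. x i) \<in> borel_measurable ?M" if "i \<in> K" for i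
    using measurable_component_singleton[OF that, of "\<lambda>_. lborel :: real measure"] by simp
  have "{x \<in> space ?M. \<forall>i\<in>K. 0 \<le> x i} \<in> sets ?M"
    using assms(1) coord by (intro sets.sets_Collect_finite_All borel_measurable_le) auto
  moreover have "{x \<in> space ?M. \<forall>i\<in>C. x (f i) + x (g i) \<le> b i} \<in> sets ?M"
    using assms(2-4) coord
    by (intro sets.sets_Collect_finite_All borel_measurable_le borel_measurable_add) auto
  moreover have "{x \<in> K \<rightarrow>\<^sub>E {0..}. \<forall>i\<in>C. x (f i) + x (g i) \<le> b i}
      = {x \<in> space ?M. \<forall>i\<in>K. 0 \<le> x i} \<inter> {x \<in> space ?M. \<forall>i\<in>C. x (f i) + x (g i) \<le> b i}"
    by (auto simp: space_PiM PiE_iff)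
  ultimately show ?thesis by simp
qed

section \<open>Blocks with one central coordinate\<close>

text \<open>
  The pairs of coordinates that occur together in a constraint form a star graph with centre \<open>m\<close>
  and leaves \<open>I\<close>. One leaf gives the triangle, two leaves give the last block in odd dimension.
\<close>

definition star :: "'i \<Rightarrow> 'i set \<Rightarrow> ('i \<Rightarrow> nat) \<Rightarrow> ('i \<Rightarrow> real) set" where
  "star m I c = {x \<in> insert m I \<rightarrow>\<^sub>E {0..}. \<forall>i\<in>I. x m + x i \<le> real (c i)}"

lemma sets_star:
  assumes "finite I"
  shows "star m I c \<in> sets (PiM (insert m I) (\<lambda>_. lborel))"
  unfolding star_def using assms by (intro sets_pairwise_bounded) auto

text \<open>
  The central coordinate ranges over \<open>[0, c k]\<close>, where \<open>k\<close> carries the smallest bound; fixing its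
  value \<open>y\<close> leaves the box with sides \<open>[0, c i - y]\<close>.
\<close>

lemma emeasure_star:
  assumes "finite I" "m \<notin> I" "k \<in> I" "\<And>i. i \<in> I \<Longrightarrow> c k \<le> c i"
  shows "emeasure (PiM (insert m I) (\<lambda>_. lborel)) (star m I c)
       = (\<integral>\<^sup>+y. ennreal (\<Prod>i\<in>I. real (c i) - y) * indicator {0..real (c k)} y \<partial>lborel)"
proof -
  interpret product_sigma_finite "\<lambda>_::'a. lborel :: real measure"
    by unfold_locales
  let ?M = "PiM I (\<lambda>_. lborel :: real measure)"
  \<comment> \<open>By Fubini with the central coordinate outermost, only the volume of each slice is needed.\<close>
  have section_eq: "(\<integral>\<^sup>+x. indicator (star m I c) (x(m := y)) \<partial>?M)
      = ennreal (\<Prod>i\<in>I. real (c i) - y) * indicator {0..real (c k)} y" for y :: real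
  proof (cases "y \<in> {0..real (c k)}")
    case True
    then have le: "y \<le> real (c i)" if "i \<in> I" for i
      using assms(4)[OF that] by auto
    have "(\<integral>\<^sup>+x. indicator (star m I c) (x(m := y)) \<partial>?M)
        = (\<integral>\<^sup>+x. indicator (PiE I (\<lambda>i. {0..real (c i) - y})) x \<partial>?M)"
      using True assms(2)
      by (intro nn_integral_cong)
         (fastforce simp: star_def indicator_def space_PiM PiE_iff extensional_def)
    also have "\<dots> = (\<Prod>i\<in>I. ennreal (real (c i) - y))"
      using assms(1) le by (simp add: sets_PiM_I_finite emeasure_PiM)
    also have "\<dots> = ennreal (\<Prod>i\<in>I. real (c i) - y)"
      using le by (intro prod_ennreal) auto
    finally show ?thesis using True by simp
  next
    case False
    have "x(m := y) \<notin> star m I c" for x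
    proof
      assume "x(m := y) \<in> star m I c"
      then have "0 \<le> y" "0 \<le> x k" "y + x k \<le> real (c k)"
        using assms(2,3) by (auto simp: star_def PiE_iff split: if_splits)
      with False show False by auto
    qed
    with False show ?thesis by simp
  qed
  have "emeasure (PiM (insert m I) (\<lambda>_. lborel)) (star m I c)
      = (\<integral>\<^sup>+x. indicator (star m I c) x \<partial>PiM (insert m I) (\<lambda>_. lborel))"
    using sets_star[OF assms(1)] by simp
  also have "\<dots> = (\<integral>\<^sup>+y. (\<integral>\<^sup>+x. indicator (star m I c) (x(m := y)) \<partial>?M) \<partial>lborel)"
    using assms(1,2) sets_star[OF assms(1)]
    by (intro product_nn_integral_insert_rev) auto
  finally show ?thesis
    by (simp add: section_eq)
qed

lemma card_star_Ints:
  assumes "finite I" "m \<notin> I" "k \<in> I" "\<And>i. i \<in> I \<Longrightarrow> c k \<le> c i"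
  shows "card (star m I c \<inter> (insert m I \<rightarrow>\<^sub>E \<int>)) = (\<Sum>y\<le>c k. \<Prod>i\<in>I. c i - y + 1)"
proof -
  \<comment> \<open>The lattice points whose central coordinate is \<open>y\<close> form a product of finite sets.\<close>
  define L where "L y = PiE (insert m I) (\<lambda>i. real ` (if i = m then {y} else {..c i - y}))" for y
  have "star m I c \<inter> (insert m I \<rightarrow>\<^sub>E \<int>) = (\<Union>y\<le>c k. L y)"
  proof (intro equalityI subsetI)
    fix x assume x: "x \<in> star m I c \<inter> (insert m I \<rightarrow>\<^sub>E \<int>)"
    have nat: "\<exists>n. x i = real n" if "i \<in> insert m I" for i
    proof -
      have "x i \<in> \<int>" "0 \<le> x i"
        using x that by (auto simp: star_def PiE_iff)
      then show ?thesis
        by (metis Nats_altdef2 Nats_cases mem_Collect_eq)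
    qed
    then obtain n where n: "\<And>i. i \<in> insert m I \<Longrightarrow> x i = real (n i)"
      by metis
    have le: "n m + n i \<le> c i" if "i \<in> I" for i
    proof -
      have "real (n m) + real (n i) \<le> real (c i)"
        using x n that by (auto simp: star_def)
      then show ?thesis by linarith
    qed
    have "n m \<le> c k" using le[OF assms(3)] by simp
    moreover have "x i \<in> real ` (if i = m then {n m} else {..c i - n m})" if "i \<in> insert m I" for i
    proof (cases "i = m")
      case False
      with that have "i \<in> I" by simp
      with le[of i] n[OF that] False show ?thesis by auto
    qed (use n in auto)
    moreover have "x \<in> extensional (insert m I)" using x by (simp add: PiE_def)
    ultimately have "n m \<in> {..c k}" "x \<in> L (n m)"
      unfolding L_def PiE_iff by (blast, blast)
    then show "x \<in> (\<Union>y\<le>c k. L y)" by blast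
  next
    fix x assume "x \<in> (\<Union>y\<le>c k. L y)"
    then obtain y where y: "y \<le> c k" "x \<in> L y" by auto
    have xm: "x m = real y" and ext: "x \<in> extensional (insert m I)"
      using y by (auto simp: L_def PiE_iff)
    have xi: "\<exists>a. x i = real a \<and> a + y \<le> c i" if "i \<in> I" for i
    proof -
      have "x i \<in> real ` {..c i - y}"
        using y that assms(2) by (auto simp: L_def PiE_iff split: if_splits)
      then obtain a where "x i = real a" "a \<le> c i - y" by auto
      moreover have "y \<le> c i" using y assms(4)[OF that] by simp
      ultimately show ?thesis by auto
    qed
    have "x m + x i \<le> real (c i)" "0 \<le> x i" "x i \<in> \<int>" if "i \<in> I" for i
      using xi[OF that] xm by auto
    with xm ext show "x \<in> star m I c \<inter> (insert m I \<rightarrow>\<^sub>E \<int>)"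
      by (auto simp: star_def PiE_iff)
  qed
  moreover have "card (\<Union>y\<le>c k. L y) = (\<Sum>y\<le>c k. card (L y))"
  proof (rule card_UN_disjoint)
    show "\<forall>y\<in>{..c k}. finite (L y)"
      using assms(1) by (auto simp: L_def intro!: finite_PiE)
    show "\<forall>y\<in>{..c k}. \<forall>z\<in>{..c k}. y \<noteq> z \<longrightarrow> L y \<inter> L z = {}"
      by (auto simp: L_def PiE_iff)
  qed simp
  moreover have "card (L y) = (\<Prod>i\<in>I. c i - y + 1)" for y
  proof -
    have "card (L y) = (\<Prod>i\<in>insert m I. card (real ` (if i = m then {y} else {..c i - y})))"
      unfolding L_def using assms(1) by (intro card_PiE) simp
    also have "\<dots> = (\<Prod>i\<in>I. card (real ` (if i = m then {y} else {..c i - y})))"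
      using assms(1,2) by simp
    also have "\<dots> = (\<Prod>i\<in>I. c i - y + 1)"
      using assms(2) by (intro prod.cong) (auto simp: card_image inj_on_def)
    finally show ?thesis .
  qed
  ultimately show ?thesis by simp
qed

lemma measure_triangle:
  assumes "m \<noteq> a"
  shows "measure (PiM {m, a} (\<lambda>_. lborel)) (star m {a} (\<lambda>_. 1)) = 1 / 2"
proof -
  have "emeasure (PiM {m, a} (\<lambda>_. lborel)) (star m {a} (\<lambda>_. 1))
      = (\<integral>\<^sup>+y. ennreal (1 - y) * indicator {0..1} y \<partial>lborel)"
    using emeasure_star[of "{a}" m a "\<lambda>_. 1"] assms by simp
  also have "\<dots> = ennreal ((1 - 1\<^sup>2 / 2) - (0 - 0\<^sup>2 / 2))"
    by (rule nn_integral_FTC_Icc[where F = "\<lambda>y. y - y\<^sup>2 / 2"])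
       (auto intro!: derivative_eq_intros)
  also have "\<dots> = ennreal (1 / 2)"
    by (simp add: field_simps)
  finally show ?thesis
    by (rule measure_eq_emeasure_eq_ennreal[rotated]) simp
qed

lemma measure_end_block:
  assumes "m \<noteq> a" "m \<noteq> b" "a \<noteq> b"
  shows "measure (PiM {m, a, b} (\<lambda>_. lborel)) (star m {a, b} ((\<lambda>_. 1)(b := 2))) = 5 / 6"
proof -
  have "emeasure (PiM {m, a, b} (\<lambda>_. lborel)) (star m {a, b} ((\<lambda>_. 1)(b := 2)))
      = (\<integral>\<^sup>+y. ennreal ((1 - y) * (2 - y)) * indicator {0..1} y \<partial>lborel)"
    using emeasure_star[of "{a, b}" m a "(\<lambda>_. 1)(b := 2)"] assms by simp
  also have "\<dots> = ennreal ((2 * 1 - 3 / 2 * 1\<^sup>2 + 1 ^ 3 / 3) - (2 * 0 - 3 / 2 * 0\<^sup>2 + 0 ^ 3 / 3))"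
  proof (rule nn_integral_FTC_Icc[where F = "\<lambda>y. 2 * y - 3 / 2 * y\<^sup>2 + y ^ 3 / 3"])
    show "((\<lambda>y. 2 * y - 3 / 2 * y\<^sup>2 + y ^ 3 / 3) has_real_derivative (1 - y) * (2 - y)) (at y)" for y :: real
      by (auto intro!: derivative_eq_intros simp: algebra_simps power2_eq_square)
  qed (auto intro!: mult_nonneg_nonneg)
  also have "\<dots> = ennreal (5 / 6)"
    by simp
  finally show ?thesis
    by (rule measure_eq_emeasure_eq_ennreal[rotated]) simp
qed

lemma card_triangle:
  assumes "m \<noteq> a"
  shows "card (star m {a} (\<lambda>_. 1) \<inter> ({m, a} \<rightarrow>\<^sub>E \<int>)) = 3"
  using card_star_Ints[of "{a}" m a "\<lambda>_. 1"] assms by (simp add: atMost_Suc)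

lemma card_end_block:
  assumes "m \<noteq> a" "m \<noteq> b" "a \<noteq> b"
  shows "card (star m {a, b} ((\<lambda>_. 1)(b := 2)) \<inter> ({m, a, b} \<rightarrow>\<^sub>E \<int>)) = 8"
  using card_star_Ints[of "{a, b}" m a "(\<lambda>_. 1)(b := 2)"] assms by (simp add: atMost_Suc)

section \<open>Splitting the polytope into blocks\<close>

lemma sets_polytope_P: "polytope_P d s \<in> sets (PiM {1..d} (\<lambda>_. lborel))"
  unfolding polytope_P_def by (intro sets_pairwise_bounded) auto

text \<open>
  The constraint with index \<open>2n\<close>, the only one that links the two parts, follows from its two
  odd-numbered neighbours \<open>x\<^bsub>2n-1\<^esub> + x\<^bsub>2n\<^esub> \<le> 1\<close> and \<open>x\<^bsub>2n+1\<^esub> + x\<^bsub>2n+2\<^esub> \<le> 1\<close>. The second of these exists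
  because the right part has at least two coordinates.
\<close>

lemma polytope_P_split:
  assumes "2 \<le> k"
  shows "polytope_P (2 * n + k) 1 =
    glue {1..2 * n} (polytope_P (2 * n) 1) {2 * n + 1..2 * n + k}
      {x \<in> {2 * n + 1..2 * n + k} \<rightarrow>\<^sub>E {0..}.
         \<forall>i\<in>{2 * n + 1..2 * n + k - 1}. x i + x (i + 1) \<le> real (1 + delta i)}"
    (is "?L = ?R")
proof -
  have un: "{1..2 * n} \<union> {2 * n + 1..2 * n + k} = {1..2 * n + k}" by auto
  show ?thesis
  proof (intro equalityI subsetI)
    fix x assume "x \<in> ?L"
    then show "x \<in> ?R"
      unfolding glue_def un by (auto simp: polytope_P_def PiE_iff)
  next
    fix x assume x: "x \<in> ?R"
    have ext: "x \<in> extensional {1..2 * n + k}"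
      using x unfolding glue_def un by simp
    have left0: "0 \<le> x i" if "1 \<le> i" "i \<le> 2 * n" for i
      using x that by (auto simp: glue_def polytope_P_def PiE_iff)
    have right0: "0 \<le> x i" if "2 * n < i" "i \<le> 2 * n + k" for i
      using x that by (auto simp: glue_def PiE_iff)
    have left: "x i + x (i + 1) \<le> real (1 + delta i)" if "1 \<le> i" "i < 2 * n" for i
    proof -
      have "\<forall>i\<in>{1..2 * n - 1}. restrict x {1..2 * n} i + restrict x {1..2 * n} (i + 1)
              \<le> real (1 + delta i)"
        using x unfolding glue_def polytope_P_def by blast
      from this[rule_format, of i] that show ?thesis by simp
    qed
    have right: "x i + x (i + 1) \<le> real (1 + delta i)" if "2 * n < i" "i < 2 * n + k" for i
    proof -
      let ?J = "{2 * n + 1..2 * n + k}"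
      have "\<forall>i\<in>{2 * n + 1..2 * n + k - 1}. restrict x ?J i + restrict x ?J (i + 1)
              \<le> real (1 + delta i)"
        using x unfolding glue_def by blast
      from this[rule_format, of i] that show ?thesis by simp
    qed
    have link: "x (2 * n) + x (2 * n + 1) \<le> real (1 + delta (2 * n))" if "1 \<le> n"
    proof -
      have "x (2 * n - 1) + x (2 * n) \<le> 1" "0 \<le> x (2 * n - 1)"
        using left[of "2 * n - 1"] left0[of "2 * n - 1"] that by (auto simp: delta_def)
      moreover have "x (2 * n + 1) + x (2 * n + 2) \<le> 1" "0 \<le> x (2 * n + 2)"
        using right[of "2 * n + 1"] right0[of "2 * n + 2"] assms by (auto simp: delta_def)
      ultimately show ?thesis by (simp add: delta_def)
    qed
    have "x i + x (i + 1) \<le> real (1 + delta i)" if "1 \<le> i" "i < 2 * n + k" for i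
    proof -
      consider "i < 2 * n" | "i = 2 * n" | "2 * n < i" by linarith
      then show ?thesis
        using left[of i] right[of i] link that by cases auto
    qed
    moreover have "0 \<le> x i" if "1 \<le> i" "i \<le> 2 * n + k" for i
      using left0[of i] right0[of i] that by (cases "i \<le> 2 * n") auto
    ultimately show "x \<in> ?L"
      using ext assms by (auto simp: polytope_P_def PiE_iff)
  qed
qed

lemma polytope_P_split_triangle:
  "polytope_P (2 * n + 2) 1 =
    glue {1..2 * n} (polytope_P (2 * n) 1) {2 * n + 2, 2 * n + 1}
      (star (2 * n + 2) {2 * n + 1} (\<lambda>_. 1))"
proof -
  have J: "{2 * n + 1..2 * n + 2} = {2 * n + 2, 2 * n + 1}"
    and K: "{2 * n + 1..2 * n + 2 - 1} = {2 * n + 1}" by auto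
  have "{x \<in> {2 * n + 1..2 * n + 2} \<rightarrow>\<^sub>E {0..}.
      \<forall>i\<in>{2 * n + 1..2 * n + 2 - 1}. x i + x (i + 1) \<le> real (1 + delta i)}
      = star (2 * n + 2) {2 * n + 1} (\<lambda>_. 1)"
    unfolding J K star_def by (auto simp: delta_def add.commute)
  with polytope_P_split[of 2 n] J show ?thesis by simp
qed

lemma polytope_P_split_end_block:
  "polytope_P (2 * n + 3) 1 =
    glue {1..2 * n} (polytope_P (2 * n) 1) {2 * n + 2, 2 * n + 1, 2 * n + 3}
      (star (2 * n + 2) {2 * n + 1, 2 * n + 3} ((\<lambda>_. 1)(2 * n + 3 := 2)))"
proof -
  have J: "{2 * n + 1..2 * n + 3} = {2 * n + 2, 2 * n + 1, 2 * n + 3}"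
    and K: "{2 * n + 1..2 * n + 3 - 1} = {2 * n + 1, 2 * n + 2}" by auto
  have "{x \<in> {2 * n + 1..2 * n + 3} \<rightarrow>\<^sub>E {0..}.
      \<forall>i\<in>{2 * n + 1..2 * n + 3 - 1}. x i + x (i + 1) \<le> real (1 + delta i)}
      = star (2 * n + 2) {2 * n + 1, 2 * n + 3} ((\<lambda>_. 1)(2 * n + 3 := 2))"
    unfolding J K star_def by (auto simp: delta_def numeral_3_eq_3 add.commute)
  with polytope_P_split[of 3 n] J show ?thesis by simp
qed

section \<open>Lattice points and volume of the polytope\<close>

lemma num_lattice_glue:
  assumes P: "polytope_P d s = glue {1..e} (polytope_P e t) J B"
    and J: "{1..d} = {1..e} \<union> J" "{1..e} \<inter> J = {}"
  shows "num_lattice d s = num_lattice e t * card (B \<inter> (J \<rightarrow>\<^sub>E \<int>))"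
  unfolding num_lattice_def lattice_points_def P J(1) glue_Int_PiE
  using J(2) by (intro card_glue) (auto simp: PiE_def)

lemma euclidean_vol_glue:
  assumes P: "polytope_P d s = glue {1..e} (polytope_P e t) J B"
    and J: "{1..d} = {1..e} \<union> J" "{1..e} \<inter> J = {}"
    and B: "B \<in> sets (PiM J (\<lambda>_. lborel))"
  shows "euclidean_vol d (polytope_P d s)
       = euclidean_vol e (polytope_P e t) * measure (PiM J (\<lambda>_. lborel)) B"
proof -
  have "finite J" using J(1) by (metis finite_Un finite_atLeastAtMost)
  then show ?thesis
    unfolding euclidean_vol_def P J(1)
    using J(2) B sets_polytope_P by (intro measure_glue) auto
qed

lemma even_dimension:
  "num_lattice (2 * n) 1 = 3 ^ n \<and> euclidean_vol (2 * n) (polytope_P (2 * n) 1) = 1 / 2 ^ n"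
proof (induction n)
  case 0
  \<comment> \<open>In dimension zero there is one point, the function that is undefined everywhere.\<close>
  have "polytope_P 0 1 = {\<lambda>_. undefined}"
    by (auto simp: polytope_P_def)
  then show ?case
    by (simp add: num_lattice_def lattice_points_def euclidean_vol_def PiM_empty measure_def)
next
  case (Suc n)
  let ?J = "{2 * n + 2, 2 * n + 1}"
  have J: "{1..2 * n + 2} = {1..2 * n} \<union> ?J" "{1..2 * n} \<inter> ?J = {}" by auto
  have "num_lattice (2 * n + 2) 1 = num_lattice (2 * n) 1 * 3"
    using num_lattice_glue[OF polytope_P_split_triangle J]
      card_triangle[of "2 * n + 2" "2 * n + 1"] by simp
  moreover have "euclidean_vol (2 * n + 2) (polytope_P (2 * n + 2) 1)
      = euclidean_vol (2 * n) (polytope_P (2 * n) 1) * (1 / 2)"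
    using euclidean_vol_glue[OF polytope_P_split_triangle J sets_star]
      measure_triangle[of "2 * n + 2" "2 * n + 1"] by simp
  ultimately show ?case
    using Suc by simp
qed

lemma odd_dimension:
  "num_lattice (2 * n + 3) 1 = 8 * 3 ^ n"
  "euclidean_vol (2 * n + 3) (polytope_P (2 * n + 3) 1) = 5 / (6 * 2 ^ n)"
proof -
  let ?J = "{2 * n + 2, 2 * n + 1, 2 * n + 3}"
  have J: "{1..2 * n + 3} = {1..2 * n} \<union> ?J" "{1..2 * n} \<inter> ?J = {}" by auto
  show "num_lattice (2 * n + 3) 1 = 8 * 3 ^ n"
    using num_lattice_glue[OF polytope_P_split_end_block J] even_dimension[of n]
      card_end_block[of "2 * n + 2" "2 * n + 1" "2 * n + 3"] by simp
  have "euclidean_vol (2 * n + 3) (polytope_P (2 * n + 3) 1)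
      = euclidean_vol (2 * n) (polytope_P (2 * n) 1) * measure (PiM ?J (\<lambda>_. lborel))
          (star (2 * n + 2) {2 * n + 1, 2 * n + 3} ((\<lambda>_. 1)(2 * n + 3 := 2)))"
    by (rule euclidean_vol_glue[OF polytope_P_split_end_block J sets_star]) simp
  also have "\<dots> = 1 / 2 ^ n * (5 / 6)"
    by (subst measure_end_block) (simp_all add: even_dimension[simplified])
  finally show "euclidean_vol (2 * n + 3) (polytope_P (2 * n + 3) 1) = 5 / (6 * 2 ^ n)"
    by simp
qed

theorem corollary3p14:
  fixes r :: nat
  assumes "r \<ge> 1"
  shows "(num_lattice (2 * r) 1 = 3 ^ r \<and>
          num_lattice (2 * r + 1) 1 = 8 * 3 ^ (r - 1)) \<and>
         (fact (2 * r) * euclidean_vol (2 * r) (polytope_P (2 * r) 1) = fact (2 * r) / 2 ^ r \<and>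
          fact (2 * r + 1) * euclidean_vol (2 * r + 1) (polytope_P (2 * r + 1) 1)
            = 5 * fact (2 * r + 1) / (6 * 2 ^ (r - 1)))"
proof -
  have "2 * (r - 1) + 3 = 2 * r + 1" using assms by simp
  note odd = odd_dimension[of "r - 1", unfolded this]
  show ?thesis
    unfolding odd using even_dimension[of r] by simp
qed

end
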